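(* For every $n\ge 0$, there is a bijection between the set of unordered binary increasing trees with $n+1$ nodes and the set of t-shelves of size $n$ in which no node that is a left child of its parent has a left child.
   Context: A treeshelf (t-shelf) of size $n\ge 1$ is a rooted binary tree with $n$ nodes labeled bijectively by $\{1,\dots,n\}$ so that labels strictly increase along every path starting at the root, in which every node has at most one left child and at most one right child, and every child (including a child with no sibling) is designated either as the left child or the right child of its parent. There is a unique empty t-shelf, of size $0$. An unordered binary increasing tree with $m$ nodes is a rooted tree with nodes labeled bijectively by $\{1,\dots,m\}$, labels strictly increasing along every path from the root, in which every node has at most two children and children are not ordered (no left/right distinction). *)

theory Defs
  imports Main "HOL-Library.Tree"
begin

definition increasing_tree :: "nat tree \<Rightarrow> bool" where
  "increasing_tree t \<longleftrightarrow>
     (\<forall>l a r. \<langle>l, a, r\<rangle> \<in> subtrees t \<longrightarrow> (\<forall>x \<in> set_tree l \<union> set_tree r. a < x))"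

text \<open>The constructor \<open>\<langle>\<rangle>\<close> marks an absent child, so it is not a node; \<open>size\<close> counts the nodes.\<close>

definition t_shelves :: "nat \<Rightarrow> nat tree set" where
  "t_shelves n =
     {t. size t = n \<and> distinct (inorder t) \<and> set_tree t = {1..n} \<and> increasing_tree t}"

definition no_left_left :: "'a tree \<Rightarrow> bool" where
  "no_left_left t \<longleftrightarrow>
     (\<forall>l a r. \<langle>l, a, r\<rangle> \<in> subtrees t \<longrightarrow> l \<noteq> \<langle>\<rangle> \<longrightarrow> left l = \<langle>\<rangle>)"

text \<open>
  Since labels are bijective, nodes are identified with their labels. A rooted tree is the set of
  its (parent, child) pairs, which carries no order on the children of a node.
\<close>

definition rooted_tree :: "'a set \<Rightarrow> ('a \<times> 'a) set \<Rightarrow> bool" where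
  "rooted_tree V E \<longleftrightarrow> E \<subseteq> V \<times> V \<and>
     (\<exists>r \<in> V. (\<forall>u. (u, r) \<notin> E) \<and>
              (\<forall>v \<in> V - {r}. \<exists>!u. (u, v) \<in> E) \<and>
              (\<forall>v \<in> V. (r, v) \<in> E\<^sup>*))"

definition unordered_binary_increasing_trees :: "nat \<Rightarrow> (nat \<times> nat) set set" where
  "unordered_binary_increasing_trees m =
     {E. rooted_tree {1..m} E \<and>
         (\<forall>(u, v) \<in> E. u < v) \<and>
         (\<forall>u \<in> {1..m}. card (E `` {u}) \<le> 2)}"

end

theory Submission
  imports Defs
begin

text \<open>
  The bijection is the first-child/next-sibling correspondence. Reading a t-shelf on
  \<open>{2..n+1}\<close>, the right child of a node \<open>a\<close> becomes the smallest child of \<open>a\<close> in the unordered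
  tree, and a left child becomes the next sibling; the root of the t-shelf is the smallest child
  of the extra node \<open>1\<close>. As labels increase, the siblings along a left spine are listed in
  increasing order, so the t-shelf can be recovered from the edges. A vertex has at most two
  children iff the corresponding left spine has at most two nodes.
\<close>

section \<open>Recursive forms of the conditions on labels and left children\<close>

lemma increasing_tree_Leaf [simp]: "increasing_tree \<langle>\<rangle>"
  by (simp add: increasing_tree_def)

lemma increasing_tree_Node [simp]:
  "increasing_tree \<langle>l, a, r\<rangle> \<longleftrightarrow>
     (\<forall>x \<in> set_tree l \<union> set_tree r. a < x) \<and> increasing_tree l \<and> increasing_tree r"
  unfolding increasing_tree_def by auto

lemma no_left_left_Leaf [simp]: "no_left_left \<langle>\<rangle>"
  by (simp add: no_left_left_def)

lemma no_left_left_Node [simp]: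
  "no_left_left \<langle>l, a, r\<rangle> \<longleftrightarrow>
     (l \<noteq> \<langle>\<rangle> \<longrightarrow> left l = \<langle>\<rangle>) \<and> no_left_left l \<and> no_left_left r"
  unfolding no_left_left_def by (simp del: all_simps ex_simps) blast

lemma increasing_tree_map_Suc [simp]: "increasing_tree (map_tree Suc t) \<longleftrightarrow> increasing_tree t"
  by (induction t) (auto simp: tree.set_map)

lemma no_left_left_map [simp]: "no_left_left (map_tree f t) \<longleftrightarrow> no_left_left t"
proof (induction t)
  case (Node l a r)
  then show ?case by (cases l) (auto simp: tree.map_sel)
qed simp

section \<open>The edge set read off from a binary tree\<close>

text \<open>The parameter \<open>p\<close> is the parent of the root in the unordered tree. Siblings
  share a parent, so \<open>p\<close> is kept on the left; a right subtree lists the children of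
  \<open>a\<close>, so there \<open>a\<close> takes over.\<close>

fun sibling_edges :: "'a \<Rightarrow> 'a tree \<Rightarrow> ('a \<times> 'a) set" where
  "sibling_edges p \<langle>\<rangle> = {}"
| "sibling_edges p \<langle>l, a, r\<rangle> = insert (p, a) (sibling_edges p l \<union> sibling_edges a r)"

lemma sibling_edges_subset:
  "sibling_edges p t \<subseteq> insert p (set_tree t) \<times> set_tree t"
  by (induction p t rule: sibling_edges.induct) auto

lemma sibling_edges_memD:
  assumes "(u, v) \<in> sibling_edges p t"
  shows "u = p \<or> u \<in> set_tree t" "v \<in> set_tree t"
  using assms sibling_edges_subset[of p t] by auto

lemma Range_sibling_edges: "Range (sibling_edges p t) = set_tree t"
  by (induction p t rule: sibling_edges.induct) auto

lemma sibling_edges_reach: "v \<in> set_tree t \<Longrightarrow> (p, v) \<in> (sibling_edges p t)\<^sup>+"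
proof (induction p t rule: sibling_edges.induct)
  case (2 p l a r)
  let ?E = "sibling_edges p \<langle>l, a, r\<rangle>"
  have sub: "(sibling_edges p l)\<^sup>+ \<subseteq> ?E\<^sup>+" "(sibling_edges a r)\<^sup>+ \<subseteq> ?E\<^sup>+"
    by (auto intro: trancl_mono)
  have pa: "(p, a) \<in> ?E\<^sup>+" by auto
  from "2.prems" consider "v \<in> set_tree l" | "v = a" | "v \<in> set_tree r" by auto
  then show ?case
  proof cases
    case 1
    then show ?thesis using "2.IH"(1) sub by blast
  next
    case 2
    then show ?thesis using pa by blast
  next
    case 3
    then show ?thesis using "2.IH"(2) sub pa by (meson subsetD trancl_trans)
  qed
qed simp

text \<open>By distinctness, and since \<open>p\<close> is no label of the tree, no edge leaves
  \<open>insert a (set_tree r)\<close>. Hence the edges alone determine which labels lie in the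
  right subtree.\<close>

lemma descendants_sibling_edges:
  assumes "distinct (inorder \<langle>l, a, r\<rangle>)" "p \<notin> set_tree \<langle>l, a, r\<rangle>"
  shows "(sibling_edges p \<langle>l, a, r\<rangle>)\<^sup>+ `` {a} = set_tree r"
proof
  let ?E = "sibling_edges p \<langle>l, a, r\<rangle>"
  have step: "v \<in> set_tree r" if "(u, v) \<in> ?E" "u \<in> insert a (set_tree r)" for u v
    using that assms by (auto dest: sibling_edges_memD)
  have "v \<in> set_tree r" if "(a, v) \<in> ?E\<^sup>+" for v
    using that by (induction rule: trancl_induct) (use step in blast)+
  then show "?E\<^sup>+ `` {a} \<subseteq> set_tree r" by auto
  have "(sibling_edges a r)\<^sup>+ \<subseteq> ?E\<^sup>+"
    by (auto intro: trancl_mono)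
  then show "set_tree r \<subseteq> ?E\<^sup>+ `` {a}"
    using sibling_edges_reach[of _ r a] by blast
qed

text \<open>The edges determine the root as the smallest label, the labels on the right as its
  proper descendants, and the labels on the left as the remaining ones. Induction then applies to
  the two subtrees.\<close>

lemma sibling_edges_inject:
  fixes t t' :: "nat tree"
  assumes "sibling_edges p t = sibling_edges p t'"
    and "distinct (inorder t)" "increasing_tree t" "p \<notin> set_tree t"
    and "distinct (inorder t')" "increasing_tree t'" "p \<notin> set_tree t'"
  shows "t = t'"
  using assms
proof (induction p t arbitrary: t' rule: sibling_edges.induct)
  case (1 p)
  then show ?case by (cases t') auto
next
  case (2 p l a r)
  let ?E = "sibling_edges p \<langle>l, a, r\<rangle>"
  obtain l' b r' where t': "t' = \<langle>l', b, r'\<rangle>"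
    using "2.prems"(1) by (cases t') auto
  have sets: "set_tree \<langle>l, a, r\<rangle> = set_tree \<langle>l', b, r'\<rangle>"
    using "2.prems"(1) Range_sibling_edges t' by metis
  have "a \<le> b" "b \<le> a"
  proof -
    have "b \<in> set_tree \<langle>l, a, r\<rangle>" "a \<in> set_tree \<langle>l', b, r'\<rangle>" using sets by auto
    then show "a \<le> b" "b \<le> a" using "2.prems"(3,6) unfolding t' by (auto intro: less_imp_le)
  qed
  then have b: "b = a" by simp
  have r_set: "set_tree r' = set_tree r"
    using descendants_sibling_edges[of l a r p] descendants_sibling_edges[of l' a r' p] "2.prems"
    unfolding t' b by metis
  have l_set: "set_tree l' = set_tree l"
    using sets r_set "2.prems"(2,5) unfolding t' b by auto
  \<comment> \<open>By distinctness, the edges of a subtree are exactly those whose target is one of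
    its labels.\<close>
  have restrict: "sibling_edges a y = sibling_edges p \<langle>x, a, y\<rangle> \<inter> UNIV \<times> set_tree y"
    "sibling_edges p x = sibling_edges p \<langle>x, a, y\<rangle> \<inter> UNIV \<times> set_tree x"
    if "distinct (inorder \<langle>x, a, y\<rangle>)" for x y
    using that by (auto dest: sibling_edges_memD)
  have "sibling_edges a r = sibling_edges a r'"
    using restrict(1)[of l r] restrict(1)[of l' r'] "2.prems"(1,2,5) r_set unfolding t' b by metis
  then have "r = r'"
    using "2.IH"(2)[of r'] "2.prems" unfolding t' b by auto
  moreover have "sibling_edges p l = sibling_edges p l'"
    using restrict(2)[of l r] restrict(2)[of l' r'] "2.prems"(1,2,5) l_set unfolding t' b by metis
  then have "l = l'"
    using "2.IH"(1)[of l'] "2.prems" unfolding t' b by auto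
  ultimately show ?case by (simp add: t' b)
qed

section \<open>Unordered increasing trees as parent relations, and surjectivity\<close>

text \<open>Such a relation is an increasing tree with root \<open>p\<close>: parents are smaller
  than their children, so following parents upwards from any vertex must end in
  \<open>p\<close>.\<close>

definition increasing_parent_relations :: "nat \<Rightarrow> nat set \<Rightarrow> (nat \<times> nat) set set" where
  "increasing_parent_relations p S =
     {E. E \<subseteq> insert p S \<times> S \<and> (\<forall>v \<in> S. \<exists>!u. (u, v) \<in> E) \<and> (\<forall>(u, v) \<in> E. u < v)}"

lemma sibling_edges_in_parent_relations:
  assumes "distinct (inorder t)" "increasing_tree t" "\<forall>x \<in> set_tree t. p < x"
  shows "sibling_edges p t \<in> increasing_parent_relations p (set_tree t)"
  using assms
proof (induction p t rule: sibling_edges.induct)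
  case (2 p l a r)
  have "sibling_edges p l \<in> increasing_parent_relations p (set_tree l)"
    "sibling_edges a r \<in> increasing_parent_relations a (set_tree r)"
    using 2 by auto
  then have L: "\<forall>v \<in> set_tree l. \<exists>!u. (u, v) \<in> sibling_edges p l"
      "\<forall>(u, v) \<in> sibling_edges p l. u < v"
    and R: "\<forall>v \<in> set_tree r. \<exists>!u. (u, v) \<in> sibling_edges a r"
      "\<forall>(u, v) \<in> sibling_edges a r. u < v"
    unfolding increasing_parent_relations_def by simp_all
  let ?E = "sibling_edges p \<langle>l, a, r\<rangle>"
  have "\<exists>!u. (u, v) \<in> ?E" if v: "v \<in> set_tree \<langle>l, a, r\<rangle>" for v
  proof -
    consider "v \<in> set_tree l" | "v = a" | "v \<in> set_tree r" using v by auto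
    then show ?thesis
    proof cases
      case 1
      then have "(u, v) \<in> ?E \<longleftrightarrow> (u, v) \<in> sibling_edges p l" for u
        using "2.prems"(1) by (auto dest: sibling_edges_memD)
      then show ?thesis using L 1 by simp
    next
      case 2
      then have "(u, v) \<in> ?E \<longleftrightarrow> u = p" for u
        using "2.prems"(1) by (auto dest: sibling_edges_memD)
      then show ?thesis by simp
    next
      case 3
      then have "(u, v) \<in> ?E \<longleftrightarrow> (u, v) \<in> sibling_edges a r" for u
        using "2.prems"(1) by (auto dest: sibling_edges_memD)
      then show ?thesis using R 3 by simp
    qed
  qed
  moreover have "\<forall>(u, v) \<in> ?E. u < v"
    using L(2) R(2) "2.prems"(3) by auto
  ultimately show ?case
    using sibling_edges_subset[of p "\<langle>l, a, r\<rangle>"]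
    unfolding increasing_parent_relations_def by blast
qed (simp add: increasing_parent_relations_def)

text \<open>Inverse construction by induction on the number of labels: the root is the smallest
  child \<open>a\<close> of \<open>p\<close>, the right subtree encodes the descendants of
  \<open>a\<close>, and the left subtree encodes the later siblings of \<open>a\<close> with their
  descendants.\<close>

lemma parent_relations_surj:
  assumes "finite S" "E \<in> increasing_parent_relations p S"
  shows "\<exists>t. distinct (inorder t) \<and> increasing_tree t \<and> set_tree t = S \<and> sibling_edges p t = E"
  using assms
proof (induction "card S" arbitrary: p S E rule: less_induct)
  case less
  have sub: "E \<subseteq> insert p S \<times> S" and parent: "\<And>v. v \<in> S \<Longrightarrow> \<exists>!u. (u, v) \<in> E"
    and incr: "\<And>u v. (u, v) \<in> E \<Longrightarrow> u < v"
    using less.prems(2) unfolding increasing_parent_relations_def by auto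
  show ?case
  proof (cases "S = {}")
    case True
    then show ?thesis using sub by (intro exI[of _ "\<langle>\<rangle>"]) auto
  next
    case False
    define a where "a = Min S"
    have a: "a \<in> S" "\<And>v. v \<in> S \<Longrightarrow> a \<le> v"
      using False less.prems(1) by (auto simp: a_def)
    \<comment> \<open>A parent of \<open>a\<close> in \<open>S\<close> would be a label of
      \<open>S\<close> below the minimum.\<close>
    have pa: "(u, a) \<in> E \<longleftrightarrow> u = p" for u
    proof -
      have "u = p" if "(u, a) \<in> E" for u
        using sub incr[OF that] that a(2)[of u] by auto
      then show ?thesis using parent[OF a(1)] by blast
    qed
    define R where "R = E\<^sup>+ `` {a}"
    define L where "L = S - insert a R"
    have a_less: "a < v" if "(a, v) \<in> E\<^sup>+" for v
      using that by (induction rule: trancl_induct) (use incr less_trans in blast)+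
    have "R \<subseteq> S"
      unfolding R_def using sub by (auto elim: tranclE)
    have S: "S = insert a (L \<union> R)" and disj: "a \<notin> L" "a \<notin> R" "L \<inter> R = {}"
      using \<open>R \<subseteq> S\<close> a(1) a_less by (auto simp: L_def R_def)
    have fin: "finite L" "finite R"
      using S less.prems(1) by (metis finite_Un finite_insert)+
    have card: "card L < card S" "card R < card S"
      by (rule psubset_card_mono[OF less.prems(1)]; use S disj in blast)+
    \<comment> \<open>A path from \<open>a\<close> to \<open>v\<close> ends with the unique edge
      into \<open>v\<close>, so it passes through the parent of \<open>v\<close> or starts
      there.\<close>
    have parent_R: "u \<in> insert a R" if "(u, v) \<in> E" "v \<in> R" for u v
    proof -
      have "(a, v) \<in> E\<^sup>+" using that by (simp add: R_def)
      then obtain w where "(w, v) \<in> E" "w = a \<or> (a, w) \<in> E\<^sup>+" by (auto elim: tranclE)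
      moreover have "w = u" using parent[of v] that \<open>R \<subseteq> S\<close> \<open>(w, v) \<in> E\<close> by blast
      ultimately show ?thesis by (auto simp: R_def)
    qed
    \<comment> \<open>A vertex whose parent is \<open>a\<close> or a descendant of \<open>a\<close>
      would itself lie in \<open>R\<close>.\<close>
    have parent_L: "u \<in> insert p L" if "(u, v) \<in> E" "v \<in> L" for u v
    proof -
      have "u \<notin> insert a R"
        using that by (auto simp: L_def R_def intro: trancl_into_trancl)
      then show ?thesis using sub that S by auto
    qed
    define ER where "ER = E \<inter> UNIV \<times> R"
    define EL where "EL = E \<inter> UNIV \<times> L"
    have "ER \<in> increasing_parent_relations a R"
      unfolding increasing_parent_relations_def ER_def
      using parent_R parent incr \<open>R \<subseteq> S\<close> by fastforce
    then obtain r where r: "distinct (inorder r)" "increasing_tree r" "set_tree r = R"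
      "sibling_edges a r = ER"
      using less.hyps card fin by blast
    have "EL \<in> increasing_parent_relations p L"
      unfolding increasing_parent_relations_def EL_def
      using parent_L parent incr S by fastforce
    then obtain l where l: "distinct (inorder l)" "increasing_tree l" "set_tree l = L"
      "sibling_edges p l = EL"
      using less.hyps card fin by blast
    have "E = insert (p, a) (EL \<union> ER)"
      using sub S pa by (auto simp: EL_def ER_def)
    moreover have "a < v" if "v \<in> L \<union> R" for v
      using that a(2)[of v] S disj by (metis UnCI UnE insertCI order_le_less)
    ultimately show ?thesis
      using l r S disj by (intro exI[of _ "\<langle>l, a, r\<rangle>"]) auto
  qed
qed

section \<open>Numbers of children and lengths of left spines\<close>

fun left_spine :: "'a tree \<Rightarrow> nat" where
  "left_spine \<langle>\<rangle> = 0"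
| "left_spine \<langle>l, a, r\<rangle> = Suc (left_spine l)"

lemma finite_sibling_edges [simp]: "finite (sibling_edges p t)"
  by (induction p t rule: sibling_edges.induct) auto

lemma card_children_eq_left_spine:
  assumes "distinct (inorder t)" "p \<notin> set_tree t"
  shows "card (sibling_edges p t `` {p}) = left_spine t"
  using assms
proof (induction t)
  case (Node l a r)
  have "sibling_edges p \<langle>l, a, r\<rangle> `` {p} = insert a (sibling_edges p l `` {p})"
    using Node.prems by (auto dest: sibling_edges_memD)
  moreover have "a \<notin> sibling_edges p l `` {p}"
    using Node.prems by (auto dest: sibling_edges_memD)
  ultimately show ?case using Node by simp
qed simp

lemma left_spine_le_1_iff: "left_spine t \<le> Suc 0 \<longleftrightarrow> (t \<noteq> \<langle>\<rangle> \<longrightarrow> left t = \<langle>\<rangle>)"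
proof (cases t)
  case (Node l a r)
  then show ?thesis by (cases l) auto
qed simp

text \<open>The vertex \<open>p\<close> has one child more than the left spine of \<open>l\<close>
  has nodes, so the bound at \<open>p\<close> is the condition at the root of the binary tree. Every
  other vertex has the same children as in the subtree treated by the induction.\<close>

lemma no_left_left_iff_card_children:
  assumes "distinct (inorder t)" "p \<notin> set_tree t"
  shows "(\<forall>u \<in> insert p (set_tree t). card (sibling_edges p t `` {u}) \<le> 2) \<longleftrightarrow> no_left_left t"
  using assms
proof (induction p t rule: sibling_edges.induct)
  case (2 p l a r)
  let ?E = "sibling_edges p \<langle>l, a, r\<rangle>"
  have l: "?E `` {u} = sibling_edges p l `` {u}" if "u \<in> set_tree l" for u
    using "2.prems" that by (auto dest: sibling_edges_memD)
  have r: "?E `` {u} = sibling_edges a r `` {u}" if "u \<in> insert a (set_tree r)" for u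
    using "2.prems" that by (auto dest: sibling_edges_memD)
  have p: "card (?E `` {p}) = Suc (left_spine l)"
    using card_children_eq_left_spine[OF "2.prems"] by simp
  have pl: "card (sibling_edges p l `` {p}) = left_spine l"
    using "2.prems" by (intro card_children_eq_left_spine) auto
  have "set_tree \<langle>l, a, r\<rangle> = set_tree l \<union> insert a (set_tree r)" by auto
  then have "(\<forall>u \<in> insert p (set_tree \<langle>l, a, r\<rangle>). card (?E `` {u}) \<le> 2) \<longleftrightarrow>
      left_spine l \<le> Suc 0 \<and> (\<forall>u \<in> set_tree l. card (sibling_edges p l `` {u}) \<le> 2) \<and>
      (\<forall>u \<in> insert a (set_tree r). card (sibling_edges a r `` {u}) \<le> 2)"
    using l r p by (simp only: ball_simps ball_Un) auto
  \<comment> \<open>Adding \<open>p\<close> to the first quantifier changes nothing: its number of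
    children within \<open>l\<close> is \<open>left_spine l\<close>, already bounded by 1.\<close>
  also have "\<dots> \<longleftrightarrow> left_spine l \<le> Suc 0 \<and>
      (\<forall>u \<in> insert p (set_tree l). card (sibling_edges p l `` {u}) \<le> 2) \<and>
      (\<forall>u \<in> insert a (set_tree r). card (sibling_edges a r `` {u}) \<le> 2)"
    using pl by auto
  also have "\<dots> \<longleftrightarrow> left_spine l \<le> Suc 0 \<and> no_left_left l \<and> no_left_left r"
    using 2 by simp
  finally show ?case by (simp add: left_spine_le_1_iff del: sibling_edges.simps)
qed simp

section \<open>The bijection for an arbitrary root and label set\<close>

lemma bij_betw_sibling_edges:
  assumes "finite S" "\<forall>x \<in> S. p < x"
  shows "bij_betw (sibling_edges p)
    {t. distinct (inorder t) \<and> increasing_tree t \<and> set_tree t = S \<and> no_left_left t}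
    {E \<in> increasing_parent_relations p S. \<forall>u \<in> insert p S. card (E `` {u}) \<le> 2}"
    (is "bij_betw _ ?T ?F")
proof (rule bij_betw_imageI)
  have p: "p \<notin> S" using assms(2) by blast
  show "inj_on (sibling_edges p) ?T"
    using p by (auto intro!: inj_onI sibling_edges_inject)
  show "sibling_edges p ` ?T = ?F"
  proof (intro equalityI subsetI)
    fix E assume "E \<in> sibling_edges p ` ?T"
    then obtain t where t: "t \<in> ?T" "E = sibling_edges p t" by blast
    then show "E \<in> ?F"
      using sibling_edges_in_parent_relations[of t p] no_left_left_iff_card_children[of t p]
        assms(2) p by auto
  next
    fix E assume E: "E \<in> ?F"
    then obtain t where t: "distinct (inorder t)" "increasing_tree t" "set_tree t = S"
      "sibling_edges p t = E"
      using parent_relations_surj[OF assms(1), of E p] by blast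
    then have "no_left_left t"
      using no_left_left_iff_card_children[of t p] E p by auto
    then show "E \<in> sibling_edges p ` ?T" using t by blast
  qed
qed

section \<open>Rooted trees on an initial segment, and the shift of labels\<close>

text \<open>No label is smaller than 1, so 1 has no parent and must be the root. Conversely, strong
  induction along parents shows that every vertex is reachable from 1.\<close>

lemma rooted_tree_increasing_iff:
  assumes "\<forall>(u, v) \<in> E. u < v"
  shows "rooted_tree {1..n + 1} E \<longleftrightarrow> E \<in> increasing_parent_relations 1 {2..n + 1}"
proof
  assume "rooted_tree {1..n + 1} E"
  then obtain r where sub: "E \<subseteq> {1..n + 1} \<times> {1..n + 1}"
    and r: "\<forall>u. (u, r) \<notin> E" "\<forall>v \<in> {1..n + 1} - {r}. \<exists>!u. (u, v) \<in> E"
    unfolding rooted_tree_def by blast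
  have no1: "(u, 1) \<notin> E" for u
    using sub assms by fastforce
  have "r = 1"
  proof (rule ccontr)
    assume "r \<noteq> 1"
    then have "\<exists>!u. (u, 1) \<in> E" using r(2) by simp
    then show False using no1 by blast
  qed
  have "{1..n + 1} - {1} = {2..n + 1}" "insert 1 {2..n + 1} = {1..n + 1}" by auto
  moreover have "E \<subseteq> {1..n + 1} \<times> ({1..n + 1} - {1})"
    using sub no1 by auto
  ultimately show "E \<in> increasing_parent_relations 1 {2..n + 1}"
    using r(2) assms unfolding increasing_parent_relations_def \<open>r = 1\<close> by simp
next
  assume "E \<in> increasing_parent_relations 1 {2..n + 1}"
  then have sub: "E \<subseteq> insert 1 {2..n + 1} \<times> {2..n + 1}"
    and parent: "\<forall>v \<in> {2..n + 1}. \<exists>!u. (u, v) \<in> E"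
    unfolding increasing_parent_relations_def by auto
  have eq: "{1..n + 1} - {1} = {2..n + 1}" "insert 1 {2..n + 1} = {1..n + 1}" by auto
  have reach: "(1, v) \<in> E\<^sup>*" if "v \<in> {1..n + 1}" for v
    using that
  proof (induction v rule: less_induct)
    case (less v)
    show ?case
    proof (cases "v = 1")
      case False
      then have "v \<in> {2..n + 1}" using less.prems by auto
      then obtain u where u: "(u, v) \<in> E" using parent by blast
      then have "u < v" "u \<in> {1..n + 1}" using assms sub unfolding eq by blast+
      then show ?thesis using less.IH u by (meson rtrancl.rtrancl_into_rtrancl)
    qed simp
  qed
  have "E \<subseteq> {1..n + 1} \<times> {1..n + 1}" using sub by auto
  moreover have "\<forall>u. (u, 1) \<notin> E" using sub by auto
  ultimately show "rooted_tree {1..n + 1} E"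
    unfolding rooted_tree_def using parent reach eq
    by (intro conjI bexI[of _ 1]) auto
qed

lemma unordered_binary_increasing_trees_eq:
  "unordered_binary_increasing_trees (n + 1) =
     {E \<in> increasing_parent_relations 1 {2..n + 1}. \<forall>u \<in> insert 1 {2..n + 1}. card (E `` {u}) \<le> 2}"
proof -
  have "insert 1 {2..n + 1} = {1..n + 1}" by auto
  moreover have "\<forall>(u, v) \<in> E. u < v" if "E \<in> increasing_parent_relations 1 {2..n + 1}" for E
    using that by (simp add: increasing_parent_relations_def)
  ultimately show ?thesis
    unfolding unordered_binary_increasing_trees_def using rooted_tree_increasing_iff[of _ n]
    by (intro Collect_cong) metis
qed

text \<open>The shift frees the label 1 for the extra root of the unordered tree.\<close>

lemma bij_betw_map_tree_Suc:
  "bij_betw (map_tree Suc) {t \<in> t_shelves n. no_left_left t}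
    {t. distinct (inorder t) \<and> increasing_tree t \<and> set_tree t = {2..n + 1} \<and> no_left_left t}"
    (is "bij_betw _ ?A ?B")
proof (rule bij_betw_imageI)
  show "inj_on (map_tree Suc) ?A"
    by (rule inj_on_subset[OF tree.inj_map]) auto
  have mem: "t \<in> ?A \<longleftrightarrow> map_tree Suc t \<in> ?B" for t
  proof -
    have "size t = n" if "distinct (inorder t)" "set_tree t = {1..n}"
      using that distinct_card[of "inorder t"] by simp
    moreover have "set_tree t = {1..n} \<longleftrightarrow> Suc ` set_tree t = {2..n + 1}"
    proof -
      have "{2..n + 1} = Suc ` {1..n}" by (simp add: image_Suc_atLeastAtMost numeral_2_eq_2)
      then show ?thesis by (metis inj_Suc inj_image_eq_iff)
    qed
    ultimately show ?thesis
      by (auto simp: t_shelves_def tree.set_map inorder_map distinct_map)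
  qed
  show "map_tree Suc ` ?A = ?B"
  proof (intro equalityI subsetI)
    fix t assume t: "t \<in> ?B"
    \<comment> \<open>The labels of \<open>t\<close> are at least 2, so the truncated subtraction
      really inverts \<open>Suc\<close>.\<close>
    have "map_tree Suc (map_tree (\<lambda>x. x - 1) t) = map_tree id t"
      unfolding tree.map_comp using t by (intro tree.map_cong) auto
    then have eq: "t = map_tree Suc (map_tree (\<lambda>x. x - 1) t)" by (simp add: tree.map_id)
    have "map_tree Suc (map_tree (\<lambda>x. x - 1) t) \<in> ?B" using t by (subst eq[symmetric])
    then have "map_tree (\<lambda>x. x - 1) t \<in> ?A" by (subst mem)
    then show "t \<in> map_tree Suc ` ?A" using eq by (rule rev_image_eqI)
  qed (use mem in blast)
qed

theorem theorem12:
  fixes n :: nat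
  shows "\<exists>f. bij_betw f (unordered_binary_increasing_trees (n + 1))
                        {t \<in> t_shelves n. no_left_left t}"
proof -
  \<comment> \<open>The explicit map starts from t-shelves; the required bijection is its
    inverse.\<close>
  have "bij_betw (sibling_edges 1 \<circ> map_tree Suc) {t \<in> t_shelves n. no_left_left t}
      (unordered_binary_increasing_trees (n + 1))"
    unfolding unordered_binary_increasing_trees_eq
    by (rule bij_betw_trans[OF bij_betw_map_tree_Suc bij_betw_sibling_edges]) auto
  then show ?thesis by (blast intro: bij_betw_inv_into)
qed

end
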